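(* Let $N,n\ge 1$ be integers, let $A_i\in\mathbf{R}^{n\times n}$ and $\tau_i>0$, $i\in\mathbf{I}[1,N]$, and consider the integral delay system $$x(t)=\sum_{i=1}^{N}A_i\int_{-\tau_i}^{0}x(t+s)\,\mathrm{d}s .$$ Then: 1. The integral delay system is exponentially stable if there exist $2N$ positive definite matrices $S_i,Q_i\in\mathbf{R}^{n\times n}$, $i\in\mathbf{I}[1,N]$, such that $$\tau_i^{2}A_i^{\mathrm{T}}Q_i^{-1}A_i-S_i<0,\quad i\in\mathbf{I}[1,N],\qquad\text{and}\qquad \sum_{i=1}^{N}S_i<\Big(\sum_{i=1}^{N}Q_i\Big)^{-1}.$$ 2. There exist $2N$ positive definite matrices $S_i,Q_i\in\mathbf{R}^{n\times n}$, $i\in\mathbf{I}[1,N]$, satisfying the nonlinear matrix inequalities of item 1 if and only if there exist $2N$ positive definite matrices $S_i,Q_i\in\mathbf{R}^{n\times n}$, $i\in\mathbf{I}[1,N]$, and a matrix $R\in\mathbf{R}^{n\times n}$ such that $$\sum_{i=1}^{N}Q_i+\sum_{i=1}^{N}S_i-\left(R^{\mathrm{T}}+R\right)<0,$$ $$\begin{bmatrix}-S_i & \tau_iA_i^{\mathrm{T}}R\\ \tau_iR^{\mathrm{T}}A_i & -Q_i\end{bmatrix}<0,\quad i\in\mathbf{I}[1,N].$$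
   Context: Notation: $\mathbf{I}[1,N]=\{1,2,\ldots,N\}$. Positive definite matrices are real symmetric; for symmetric matrices, $X<Y$ means that $Y-X$ is positive definite. Let $\tau=\max_{i\in\mathbf{I}[1,N]}\tau_i$ and let $\mathscr{C}_{n,\tau}$ be the Banach space of continuous functions from $[-\tau,0]$ to $\mathbf{R}^n$ with the topology of uniform convergence. For an initial condition $\varphi\in\mathscr{C}_{n,\tau}$, the solution $x(t)=x(t,\varphi)$ satisfies $x(t)=\varphi(t)$ for $t\in[-\tau,0)$ and the integral delay system for all $t\ge 0$. The system is exponentially stable if there exist positive constants $\alpha,\beta$ (independent of $\varphi$) such that $\|x(t)\|\le\alpha\sup_{s\in[-\tau,0)}\|\varphi(s)\|\,\mathrm{e}^{-\beta t}$ for all $t\ge0$ and all initial conditions $\varphi$. *)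

theory Defs
  imports "HOL-Analysis.Analysis"
begin

definition positive_definite :: "real^'n^'n \<Rightarrow> bool" where
  "positive_definite M \<longleftrightarrow> transpose M = M \<and> (\<forall>v. v \<noteq> 0 \<longrightarrow> 0 < v \<bullet> (M *v v))"

(* The library's < on vectors, and hence on matrices, is componentwise, so the strict order
   of symmetric matrices needs its own symbol. *)
definition matrix_less :: "real^'n^'n \<Rightarrow> real^'n^'n \<Rightarrow> bool"  (infix "\<prec>\<^sub>L" 50) where
  "X \<prec>\<^sub>L Y \<longleftrightarrow> positive_definite (Y - X)"

(* The matrix with block rows (A B) and (C D). *)
definition block_matrix ::
  "real^'n^'n \<Rightarrow> real^'m^'n \<Rightarrow> real^'n^'m \<Rightarrow> real^'m^'m \<Rightarrow> real^('n + 'm)^('n + 'm)" where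
  "block_matrix A B C D =
    (\<chi> i j. case i of
        Inl k \<Rightarrow> (case j of Inl l \<Rightarrow> A $ k $ l | Inr l \<Rightarrow> B $ k $ l)
      | Inr k \<Rightarrow> (case j of Inl l \<Rightarrow> C $ k $ l | Inr l \<Rightarrow> D $ k $ l))"

definition max_delay :: "nat \<Rightarrow> (nat \<Rightarrow> real) \<Rightarrow> real" where
  "max_delay N \<tau> = Max (\<tau> ` {1..N})"

(* Only the values of x on [-max_delay, \<infinity>) matter.  The initial condition is imposed on the
   half-open interval because x(0) is determined by the equation, so x may jump at 0.  The
   integrals are required to exist; this forces x to be continuous on [0, \<infinity>). *)
definition ids_solution ::
  "nat \<Rightarrow> (nat \<Rightarrow> real^'n^'n) \<Rightarrow> (nat \<Rightarrow> real) \<Rightarrow> (real \<Rightarrow> real^'n) \<Rightarrow> (real \<Rightarrow> real^'n) \<Rightarrow> bool" where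
  "ids_solution N A \<tau> \<phi> x \<longleftrightarrow>
     (\<forall>t\<in>{-max_delay N \<tau>..<0}. x t = \<phi> t) \<and>
     (\<forall>t\<ge>0. (\<forall>i\<in>{1..N}. (\<lambda>s. x (t + s)) integrable_on {-\<tau> i..0}) \<and>
            x t = (\<Sum>i=1..N. A i *v integral {-\<tau> i..0} (\<lambda>s. x (t + s))))"

definition ids_exponentially_stable ::
  "nat \<Rightarrow> (nat \<Rightarrow> real^'n^'n) \<Rightarrow> (nat \<Rightarrow> real) \<Rightarrow> bool" where
  "ids_exponentially_stable N A \<tau> \<longleftrightarrow>
     (\<exists>\<alpha>>0. \<exists>\<beta>>0. \<forall>\<phi> x.
        continuous_on {-max_delay N \<tau>..0} \<phi> \<longrightarrow> ids_solution N A \<tau> \<phi> x \<longrightarrow>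
        (\<forall>t\<ge>0. norm (x t) \<le> \<alpha> * (SUP s\<in>{-max_delay N \<tau>..<0}. norm (\<phi> s)) * exp (- \<beta> * t)))"

end

theory Submission
  imports Defs
begin

text \<open>
  For stability, put \<open>P = (\<Sum>i. Q i)\<^sup>-\<^sup>1\<close>, \<open>f t = x t \<bullet> P (x t)\<close> and \<open>g i t = x t \<bullet> S i (x t)\<close>. The form of the
  inverse of a sum is subadditive in the sense of \<open>inverse_sum_form_le\<close>; together with the matrix
  inequalities for the single delays and Jensen's inequality this bounds \<open>f t\<close> by the sum of the
  averages of \<open>g i\<close> over \<open>[t - \<tau> i, t]\<close> (\<open>riccati_history_bound\<close>). On the other hand
  \<open>\<Sum>i. S i < P\<close> gives \<open>\<Sum>i. g i \<le> \<kappa> f\<close> with some \<open>\<kappa> < 1\<close>. So \<open>f\<close> is bounded by averages of its own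
  past with total weight below \<open>1\<close>. Such a function has a bounded integral, hence is bounded, by a
  multiple of the integral of its initial data (\<open>averaged_inequality_bound\<close>). Since \<open>\<kappa> < 1\<close> is
  strict, the same applies to \<open>exp (2 \<beta> t) f t\<close> for small \<open>\<beta> > 0\<close>, which yields exponential decay.
  This integral argument replaces the differentiation of a Lyapunov functional, which would be
  awkward at the jump that a solution may have at time \<open>0\<close>.

  The equivalence is a duality. For positive definite \<open>Q\<close>, the number \<open>v \<bullet> Q\<^sup>-\<^sup>1 v\<close> is the maximum over \<open>u\<close> of
  \<open>2 u \<bullet> v - u \<bullet> Q u\<close> (\<open>fenchel_young\<close>, \<open>fenchel_young_attained\<close>). Reading every inverse in this way
  turns both systems into inequalities between quadratic forms that contain no inverse.
  The substitution \<open>u = R w\<close> then transforms one system into the other, with \<open>Q i\<close> replaced by a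
  congruent matrix (\<open>lmi_of_riccati\<close>, \<open>riccati_of_lmi\<close>).
\<close>

section \<open>Positive definite matrices and their inverses\<close>

lemma inner_matrix_vector_transpose:
  fixes M :: "real^'n^'m"
  shows "u \<bullet> (M *v v) = (transpose M *v u) \<bullet> v"
  by (simp add: dot_lmul_matrix)

lemma transpose_eq_iff_inner:
  fixes M :: "real^'n^'n"
  shows "transpose M = M \<longleftrightarrow> (\<forall>u v. u \<bullet> (M *v v) = v \<bullet> (M *v u))"
proof
  assume *: "\<forall>u v. u \<bullet> (M *v v) = v \<bullet> (M *v u)"
  have "transpose M *v v = M *v v" for v
    by (rule vector_eq_rdot[THEN iffD1])
       (metis * inner_commute inner_matrix_vector_transpose)
  then show "transpose M = M" by (simp add: matrix_eq)
qed (metis inner_commute inner_matrix_vector_transpose)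

lemma positive_definite_iff:
  "positive_definite M \<longleftrightarrow>
    (\<forall>u v. u \<bullet> (M *v v) = v \<bullet> (M *v u)) \<and> (\<forall>v. v \<noteq> 0 \<longrightarrow> 0 < v \<bullet> (M *v v))"
  by (simp add: positive_definite_def transpose_eq_iff_inner)

lemma positive_definite_sym:
  "positive_definite M \<Longrightarrow> u \<bullet> (M *v v) = v \<bullet> (M *v u)"
  by (simp add: positive_definite_iff)

lemma positive_definite_nonneg:
  "positive_definite M \<Longrightarrow> 0 \<le> v \<bullet> (M *v v)"
  by (cases "v = 0") (auto simp: positive_definite_iff less_imp_le)

lemma positive_definite_congruence:
  fixes T :: "real^'n^'n"
  assumes "positive_definite M" "invertible T"
  shows "positive_definite (transpose T ** M ** T)"
proof -
  have *: "u \<bullet> ((transpose T ** M ** T) *v v) = (T *v u) \<bullet> (M *v (T *v v))" for u v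
    by (simp only: matrix_vector_mul_assoc[symmetric] inner_matrix_vector_transpose[of u]
        transpose_transpose)
  have "T *v v \<noteq> 0" if "v \<noteq> 0" for v
    using assms(2) that by (metis invertible_left_inverse matrix_left_invertible_ker)
  then show ?thesis
    using assms(1) by (simp add: positive_definite_iff *)
qed

lemma sum_matrix_vector_mult:
  fixes M :: "'i \<Rightarrow> real^'n^'m"
  shows "(\<Sum>i\<in>I. M i) *v v = (\<Sum>i\<in>I. M i *v v)"
  by (induction I rule: infinite_finite_induct) (auto simp: matrix_vector_mult_add_rdistrib)

lemma inner_sum_matrix:
  fixes M :: "'i \<Rightarrow> real^'n^'n"
  shows "u \<bullet> ((\<Sum>i\<in>I. M i) *v v) = (\<Sum>i\<in>I. u \<bullet> (M i *v v))"
  by (simp add: sum_matrix_vector_mult inner_sum_right)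

lemma positive_definite_sum:
  assumes "finite I" "I \<noteq> {}" "\<And>i. i \<in> I \<Longrightarrow> positive_definite (M i)"
  shows "positive_definite (\<Sum>i\<in>I. M i)"
  using assms unfolding positive_definite_iff inner_sum_matrix
  by (auto intro!: sum_pos cong: sum.cong)

lemma invertible_if_inner_pos:
  fixes M :: "real^'n^'n"
  assumes "\<And>v. v \<noteq> 0 \<Longrightarrow> 0 < v \<bullet> (M *v v)"
  shows "invertible M"
proof -
  have "v = 0" if "M *v v = 0" for v
    using assms[of v] that by fastforce
  then show ?thesis
    by (simp add: invertible_left_inverse matrix_left_invertible_ker)
qed

lemma matrix_inv_cancel:
  fixes M :: "real^'n^'n"
  assumes "invertible M"
  shows "M *v (matrix_inv M *v v) = v" "matrix_inv M *v (M *v v) = v"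
proof -
  have "M ** matrix_inv M = mat 1 \<and> matrix_inv M ** M = mat 1"
    using assms unfolding invertible_def matrix_inv_def by (rule someI_ex)
  then show "M *v (matrix_inv M *v v) = v" "matrix_inv M *v (M *v v) = v"
    by (auto simp: matrix_vector_mul_assoc)
qed

lemma positive_definite_invertible: "positive_definite M \<Longrightarrow> invertible M"
  by (rule invertible_if_inner_pos) (simp add: positive_definite_iff)

lemma invertible_matrix_inv:
  fixes M :: "real^'n^'n"
  assumes "invertible M"
  shows "invertible (matrix_inv M)"
  using matrix_inv_cancel(1)[OF assms]
  by (metis invertible_left_inverse matrix_left_invertible_ker matrix_vector_mult_0_right)

lemma positive_definite_matrix_inv:
  fixes M :: "real^'n^'n"
  assumes "positive_definite M"
  shows "positive_definite (matrix_inv M)"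
proof -
  note c = matrix_inv_cancel[OF positive_definite_invertible[OF assms]]
  have eq: "u \<bullet> (matrix_inv M *v v) = (matrix_inv M *v v) \<bullet> (M *v (matrix_inv M *v u))" for u v
    by (simp add: c inner_commute)
  have "matrix_inv M *v v \<noteq> 0" if "v \<noteq> 0" for v
    using c(1)[of v] that by auto
  then have "0 < v \<bullet> (matrix_inv M *v v)" if "v \<noteq> 0" for v
    using assms that by (simp add: eq positive_definite_iff)
  moreover have "u \<bullet> (matrix_inv M *v v) = v \<bullet> (matrix_inv M *v u)" for u v
    by (metis eq positive_definite_sym[OF assms])
  ultimately show ?thesis by (simp add: positive_definite_iff)
qed

text \<open>
  The difference of the two sides is \<open>(u - w) \<bullet> Q (u - w)\<close> with \<open>w = Q\<^sup>-\<^sup>1 v\<close>, so the form of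
  \<open>Q\<^sup>-\<^sup>1\<close> is the supremum over \<open>u\<close> of the left-hand side. This description replaces all
  computations with inverses of sums and of congruent matrices below.
\<close>

lemma fenchel_young:
  fixes Q :: "real^'n^'n"
  assumes "positive_definite Q"
  shows "2 * (u \<bullet> v) - u \<bullet> (Q *v u) \<le> v \<bullet> (matrix_inv Q *v v)"
proof -
  define w where "w = matrix_inv Q *v v"
  have v: "Q *v w = v"
    by (simp add: w_def matrix_inv_cancel positive_definite_invertible[OF assms])
  have "0 \<le> (u - w) \<bullet> (Q *v (u - w))"
    by (rule positive_definite_nonneg[OF assms])
  also have "\<dots> = u \<bullet> (Q *v u) - 2 * (u \<bullet> v) + w \<bullet> v"
    using positive_definite_sym[OF assms, of u w]
    by (simp add: inner_diff_left inner_diff_right matrix_vector_mult_diff_distrib v)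
  finally show ?thesis
    by (simp add: w_def[symmetric] inner_commute)
qed

lemma fenchel_young_attained:
  fixes Q :: "real^'n^'n"
  assumes "positive_definite Q"
  shows "2 * ((matrix_inv Q *v v) \<bullet> v) - (matrix_inv Q *v v) \<bullet> (Q *v (matrix_inv Q *v v))
         = v \<bullet> (matrix_inv Q *v v)"
  by (simp add: matrix_inv_cancel positive_definite_invertible[OF assms] inner_commute)

text \<open>
  The supremum defining the left-hand side is attained at a single vector \<open>y\<close>. Splitting its value
  there over the summands gives, for each index, one candidate for the supremum that defines the
  corresponding term on the right.
\<close>

lemma inverse_sum_form_le:
  fixes Q :: "'i \<Rightarrow> real^'n^'n"
  assumes "finite I" "I \<noteq> {}" "\<And>i. i \<in> I \<Longrightarrow> positive_definite (Q i)"
  shows "(\<Sum>i\<in>I. z i) \<bullet> (matrix_inv (\<Sum>i\<in>I. Q i) *v (\<Sum>i\<in>I. z i))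
           \<le> (\<Sum>i\<in>I. z i \<bullet> (matrix_inv (Q i) *v z i))"
proof -
  let ?z = "\<Sum>i\<in>I. z i"
  define y where "y = matrix_inv (\<Sum>i\<in>I. Q i) *v ?z"
  have "?z \<bullet> (matrix_inv (\<Sum>i\<in>I. Q i) *v ?z) = 2 * (y \<bullet> ?z) - y \<bullet> ((\<Sum>i\<in>I. Q i) *v y)"
    unfolding y_def by (rule fenchel_young_attained[OF positive_definite_sum[OF assms], symmetric])
  also have "\<dots> = (\<Sum>i\<in>I. 2 * (y \<bullet> z i) - y \<bullet> (Q i *v y))"
    by (simp add: inner_sum_matrix inner_sum_right sum_subtractf sum_distrib_left)
  also have "\<dots> \<le> (\<Sum>i\<in>I. z i \<bullet> (matrix_inv (Q i) *v z i))"
    by (intro sum_mono fenchel_young assms)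
  finally show ?thesis .
qed

text \<open>
  The best constant is the minimum of the form on the unit sphere; it is attained by compactness,
  and homogeneity carries the bound from the sphere to all vectors.
\<close>

lemma positive_definite_coercive:
  fixes M :: "real^'n^'n"
  assumes "positive_definite M"
  obtains c where "c > 0" "\<And>v. c * (norm v)\<^sup>2 \<le> v \<bullet> (M *v v)"
proof -
  let ?q = "\<lambda>v::real^'n. v \<bullet> (M *v v)"
  have cont: "continuous_on (sphere 0 1) ?q"
    by (intro continuous_intros)
  have "compact (sphere (0::real^'n) 1)" "sphere (0::real^'n) 1 \<noteq> {}" by simp_all
  then obtain u where u: "u \<in> sphere 0 1" "\<And>v. v \<in> sphere 0 1 \<Longrightarrow> ?q u \<le> ?q v"
    using continuous_attains_inf[OF _ _ cont] by blast
  have "?q u * (norm v)\<^sup>2 \<le> ?q v" for v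
  proof (cases "v = 0")
    case False
    have "?q u \<le> ?q (v /\<^sub>R norm v)"
      by (rule u(2)) (use False in simp)
    also have "\<dots> = ?q v / (norm v)\<^sup>2"
      by (simp add: matrix_vector_mult_scaleR power2_eq_square divide_inverse)
    finally show ?thesis
      using False by (simp add: field_simps)
  qed simp
  moreover have "?q u > 0"
    using assms u(1) unfolding positive_definite_iff by (metis mem_sphere_0 norm_zero zero_neq_one)
  ultimately show ?thesis by (rule that[rotated])
qed

lemma quadratic_form_bounded:
  fixes M :: "real^'n^'n"
  obtains p where "p > 0" "\<And>v. v \<bullet> (M *v v) \<le> p * (norm v)\<^sup>2"
proof -
  have bl: "bounded_linear (\<lambda>v. M *v v)" by (rule matrix_vector_mul_bounded_linear)
  obtain K where K: "K > 0" "\<And>v. norm (M *v v) \<le> norm v * K"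
    using bounded_linear.pos_bounded[OF bl] by auto
  have "v \<bullet> (M *v v) \<le> K * (norm v)\<^sup>2" for v
  proof -
    have "v \<bullet> (M *v v) \<le> norm v * norm (M *v v)" by (rule norm_cauchy_schwarz)
    also have "\<dots> \<le> norm v * (norm v * K)" by (intro mult_left_mono K) simp
    finally show ?thesis by (simp add: power2_eq_square mult_ac)
  qed
  with K(1) show ?thesis by (rule that)
qed

section \<open>Block matrices\<close>

definition join_vec :: "real^'n \<Rightarrow> real^'m \<Rightarrow> real^('n + 'm)" where
  "join_vec u w = (\<chi> k. case k of Inl i \<Rightarrow> u $ i | Inr j \<Rightarrow> w $ j)"

lemma sum_UNIV_Plus:
  "(\<Sum>k\<in>(UNIV :: ('a::finite + 'b::finite) set). f k) = (\<Sum>i\<in>UNIV. f (Inl i)) + (\<Sum>j\<in>UNIV. f (Inr j))"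
  unfolding UNIV_Plus_UNIV[symmetric] by (subst sum.Plus) auto

lemma join_vec_cases:
  fixes z :: "real^('n::finite + 'm::finite)"
  obtains u w where "z = join_vec u w"
proof
  show "z = join_vec (\<chi> i. z $ Inl i) (\<chi> j. z $ Inr j)"
    by (auto simp: join_vec_def vec_eq_iff split: sum.split)
qed

lemma join_vec_eq_0_iff: "join_vec u w = 0 \<longleftrightarrow> u = 0 \<and> w = 0"
proof
  assume "join_vec u w = 0"
  then have "join_vec u w $ Inl i = 0" "join_vec u w $ Inr j = 0" for i j by simp_all
  then show "u = 0 \<and> w = 0" by (simp add: join_vec_def vec_eq_iff)
qed (auto simp: join_vec_def vec_eq_iff split: sum.split)

lemma inner_join_vec: "join_vec u w \<bullet> join_vec u' w' = u \<bullet> u' + w \<bullet> w'"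
  by (simp add: inner_vec_def sum_UNIV_Plus join_vec_def)

lemma block_matrix_mult_join_vec:
  "block_matrix A B C D *v join_vec u w = join_vec (A *v u + B *v w) (C *v u + D *v w)"
  by (auto simp: vec_eq_iff block_matrix_def join_vec_def matrix_vector_mult_def sum_UNIV_Plus
      split: sum.split)

text \<open>
  In the coordinates of the two blocks, negativity of the block matrix says that the coupling term
  is strictly dominated by the two diagonal forms. Maximizing over one block, by
  \<open>fenchel_young\<close>, is what the Schur complement does.
\<close>

lemma block_matrix_less_zero_iff:
  fixes S :: "real^'n^'n" and Q :: "real^'m^'m" and B :: "real^'m^'n"
  assumes "transpose S = S" "transpose Q = Q"
  shows "block_matrix (- S) B (transpose B) (- Q) \<prec>\<^sub>L 0 \<longleftrightarrow>
    (\<forall>u w. u \<noteq> 0 \<or> w \<noteq> 0 \<longrightarrow> 2 * (u \<bullet> (B *v w)) < u \<bullet> (S *v u) + w \<bullet> (Q *v w))"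
proof -
  let ?M = "0 - block_matrix (- S) B (transpose B) (- Q)"
  have form: "join_vec u w \<bullet> (?M *v join_vec u' w') =
      u \<bullet> (S *v u') + w \<bullet> (Q *v w') - u \<bullet> (B *v w') - u' \<bullet> (B *v w)" for u w u' w'
  proof -
    have "w \<bullet> (transpose B *v u') = u' \<bullet> (B *v w)"
      by (metis inner_commute inner_matrix_vector_transpose transpose_transpose)
    moreover have "(- S) *v u' = - (S *v u')" "(- Q) *v w' = - (Q *v w')"
      using matrix_vector_mult_diff_rdistrib[of 0 S u'] matrix_vector_mult_diff_rdistrib[of 0 Q w']
      by simp_all
    ultimately show ?thesis
      unfolding matrix_vector_mult_diff_rdistrib block_matrix_mult_join_vec inner_diff_right
        inner_join_vec inner_add_right
      by simp
  qed
  have sym: "x \<bullet> (?M *v y) = y \<bullet> (?M *v x)" for x y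
  proof -
    obtain u w where x: "x = join_vec u w" by (rule join_vec_cases)
    obtain u' w' where y: "y = join_vec u' w'" by (rule join_vec_cases)
    show ?thesis
      using assms unfolding x y form transpose_eq_iff_inner by simp
  qed
  have "(\<forall>z. z \<noteq> 0 \<longrightarrow> 0 < z \<bullet> (?M *v z)) \<longleftrightarrow>
      (\<forall>u w. u \<noteq> 0 \<or> w \<noteq> 0 \<longrightarrow> 0 < join_vec u w \<bullet> (?M *v join_vec u w))"
    by (metis join_vec_cases join_vec_eq_0_iff)
  then show ?thesis
    unfolding matrix_less_def positive_definite_iff using sym unfolding form
    by (simp add: algebra_simps)
qed

section \<open>Equivalence of the two systems of matrix inequalities\<close>

lemma riccati_less_zero_iff:
  fixes A S Q :: "real^'n^'n"
  assumes "positive_definite S" "positive_definite Q"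
  shows "r\<^sup>2 *\<^sub>R (transpose A ** matrix_inv Q ** A) - S \<prec>\<^sub>L 0 \<longleftrightarrow>
    (\<forall>u. u \<noteq> 0 \<longrightarrow> (r *\<^sub>R (A *v u)) \<bullet> (matrix_inv Q *v (r *\<^sub>R (A *v u))) < u \<bullet> (S *v u))"
proof -
  let ?M = "0 - (r\<^sup>2 *\<^sub>R (transpose A ** matrix_inv Q ** A) - S)"
  have *: "u \<bullet> (?M *v v) =
      u \<bullet> (S *v v) - (r *\<^sub>R (A *v u)) \<bullet> (matrix_inv Q *v (r *\<^sub>R (A *v v)))" for u v
  proof -
    have "u \<bullet> ((transpose A ** matrix_inv Q ** A) *v v) = (A *v u) \<bullet> (matrix_inv Q *v (A *v v))"
      by (simp only: matrix_vector_mul_assoc[symmetric] inner_matrix_vector_transpose[of u]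
          transpose_transpose)
    then show ?thesis
      by (simp add: matrix_vector_mult_diff_rdistrib scaleR_matrix_vector_assoc[symmetric]
          inner_diff_right matrix_vector_mult_scaleR power2_eq_square)
  qed
  show ?thesis
    unfolding matrix_less_def positive_definite_iff *
    using positive_definite_sym[OF assms(1)]
      positive_definite_sym[OF positive_definite_matrix_inv[OF assms(2)]] by auto
qed

lemma less_matrix_inv_iff:
  fixes P M :: "real^'n^'n"
  assumes "positive_definite P" "positive_definite M"
  shows "P \<prec>\<^sub>L matrix_inv M \<longleftrightarrow> (\<forall>v. v \<noteq> 0 \<longrightarrow> v \<bullet> (P *v v) < v \<bullet> (matrix_inv M *v v))"
  unfolding matrix_less_def positive_definite_iff
  using positive_definite_sym[OF assms(1)]
    positive_definite_sym[OF positive_definite_matrix_inv[OF assms(2)]]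
  by (auto simp: matrix_vector_mult_diff_rdistrib inner_diff_right)

lemma symmetrized_sum_less_zero_iff:
  fixes P M R :: "real^'n^'n"
  assumes "positive_definite P" "positive_definite M"
  shows "M + P - (transpose R + R) \<prec>\<^sub>L 0 \<longleftrightarrow>
    (\<forall>v. v \<noteq> 0 \<longrightarrow> v \<bullet> (M *v v) + v \<bullet> (P *v v) < 2 * (v \<bullet> (R *v v)))"
proof -
  have t: "u \<bullet> (transpose R *v v) = v \<bullet> (R *v u)" for u v
    by (metis inner_commute inner_matrix_vector_transpose transpose_transpose)
  have *: "u \<bullet> ((0 - (M + P - (transpose R + R))) *v v) =
      v \<bullet> (R *v u) + u \<bullet> (R *v v) - u \<bullet> (M *v v) - u \<bullet> (P *v v)" for u v
    unfolding matrix_vector_mult_diff_rdistrib matrix_vector_mult_add_rdistrib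
      inner_diff_right inner_add_right t by simp
  show ?thesis
    unfolding matrix_less_def positive_definite_iff *
    using positive_definite_sym[OF assms(1)] positive_definite_sym[OF assms(2)]
    by (auto simp: algebra_simps)
qed

lemma delay_block_less_zero_iff:
  fixes A S Q R :: "real^'n^'n"
  assumes "positive_definite S" "positive_definite Q"
  shows "block_matrix (- S) (r *\<^sub>R (transpose A ** R)) (r *\<^sub>R (transpose R ** A)) (- Q) \<prec>\<^sub>L 0 \<longleftrightarrow>
    (\<forall>u w. u \<noteq> 0 \<or> w \<noteq> 0 \<longrightarrow>
       2 * ((R *v w) \<bullet> (r *\<^sub>R (A *v u))) < u \<bullet> (S *v u) + w \<bullet> (Q *v w))"
proof -
  have tr: "r *\<^sub>R (transpose R ** A) = transpose (r *\<^sub>R (transpose A ** R))"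
    by (simp add: transpose_scalar matrix_transpose_mul)
  have "u \<bullet> ((r *\<^sub>R (transpose A ** R)) *v w) = (R *v w) \<bullet> (r *\<^sub>R (A *v u))" for u w
  proof -
    have "u \<bullet> (transpose A *v (R *v w)) = (R *v w) \<bullet> (A *v u)"
      by (metis inner_commute inner_matrix_vector_transpose transpose_transpose)
    then show ?thesis
      by (simp only: scaleR_matrix_vector_assoc[symmetric] inner_scaleR_right
          matrix_vector_mul_assoc[symmetric])
  qed
  then show ?thesis
    unfolding tr using assms
    by (subst block_matrix_less_zero_iff) (simp_all add: positive_definite_def)
qed

text \<open>
  The choice \<open>R = (\<Sum>i. Q i)\<^sup>-\<^sup>1\<close> and \<open>Q' i = R\<^sup>T Q i R\<close> makes \<open>\<Sum>i. Q' i = R\<close>, so the summed inequality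
  becomes \<open>\<Sum>i. S i < R\<close>. The form of \<open>Q' i\<close> at \<open>w\<close> is that of \<open>Q i\<close> at \<open>R w\<close>, hence each block
  inequality is the Young inequality for \<open>R w\<close> and \<open>r i A i u\<close> followed by the hypothesis on \<open>A i\<close>.
\<close>

theorem lmi_of_riccati:
  fixes A S Q :: "'i \<Rightarrow> real^'n^'n"
  assumes I: "finite I" "I \<noteq> {}"
    and S: "\<And>i. i \<in> I \<Longrightarrow> positive_definite (S i)"
    and Q: "\<And>i. i \<in> I \<Longrightarrow> positive_definite (Q i)"
    and riccati: "\<And>i. i \<in> I \<Longrightarrow>
      (r i)\<^sup>2 *\<^sub>R (transpose (A i) ** matrix_inv (Q i) ** A i) - S i \<prec>\<^sub>L 0"
    and less: "(\<Sum>i\<in>I. S i) \<prec>\<^sub>L matrix_inv (\<Sum>i\<in>I. Q i)"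
  defines "R \<equiv> matrix_inv (\<Sum>i\<in>I. Q i)"
  defines "Q' \<equiv> \<lambda>i. transpose R ** Q i ** R"
  shows "\<And>i. i \<in> I \<Longrightarrow> positive_definite (Q' i)"
    and "(\<Sum>i\<in>I. Q' i) + (\<Sum>i\<in>I. S i) - (transpose R + R) \<prec>\<^sub>L 0"
    and "\<And>i. i \<in> I \<Longrightarrow> block_matrix (- S i) (r i *\<^sub>R (transpose (A i) ** R))
                        (r i *\<^sub>R (transpose R ** A i)) (- Q' i) \<prec>\<^sub>L 0"
proof -
  let ?W = "\<Sum>i\<in>I. Q i"
  have W: "positive_definite ?W" and SS: "positive_definite (\<Sum>i\<in>I. S i)"
    using positive_definite_sum I S Q by blast+
  have R_inv: "invertible R"
    unfolding R_def by (intro positive_definite_invertible positive_definite_matrix_inv W)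
  show Q': "positive_definite (Q' i)" if "i \<in> I" for i
    unfolding Q'_def by (intro positive_definite_congruence Q that R_inv)
  have form: "w \<bullet> (Q' i *v w) = (R *v w) \<bullet> (Q i *v (R *v w))" for i w
    unfolding Q'_def
    by (simp only: matrix_vector_mul_assoc[symmetric] inner_matrix_vector_transpose[of w]
        transpose_transpose)
  have "v \<bullet> ((\<Sum>i\<in>I. Q' i) *v v) = v \<bullet> (R *v v)" for v
  proof -
    have "v \<bullet> ((\<Sum>i\<in>I. Q' i) *v v) = (R *v v) \<bullet> (?W *v (R *v v))"
      by (simp add: inner_sum_matrix form)
    also have "\<dots> = v \<bullet> (R *v v)"
      by (simp add: R_def matrix_inv_cancel positive_definite_invertible[OF W] inner_commute)
    finally show ?thesis .
  qed
  moreover have "v \<bullet> ((\<Sum>i\<in>I. S i) *v v) < v \<bullet> (R *v v)" if "v \<noteq> 0" for v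
    using less that less_matrix_inv_iff[OF SS W] by (simp add: R_def)
  ultimately show "(\<Sum>i\<in>I. Q' i) + (\<Sum>i\<in>I. S i) - (transpose R + R) \<prec>\<^sub>L 0"
    by (subst symmetrized_sum_less_zero_iff) (auto intro!: positive_definite_sum I Q' SS)
  fix i assume i: "i \<in> I"
  have "2 * ((R *v w) \<bullet> (r i *\<^sub>R (A i *v u))) < u \<bullet> (S i *v u) + w \<bullet> (Q' i *v w)"
    if "u \<noteq> 0 \<or> w \<noteq> 0" for u w
  proof (cases "u = 0")
    case True
    then show ?thesis using Q'[OF i] that by (simp add: positive_definite_iff)
  next
    case False
    then show ?thesis
      using riccati[OF i] fenchel_young[OF Q[OF i], of "R *v w" "r i *\<^sub>R (A i *v u)"]
      unfolding riccati_less_zero_iff[OF S[OF i] Q[OF i]] form by fastforce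
  qed
  then show "block_matrix (- S i) (r i *\<^sub>R (transpose (A i) ** R))
                        (r i *\<^sub>R (transpose R ** A i)) (- Q' i) \<prec>\<^sub>L 0"
    unfolding delay_block_less_zero_iff[OF S[OF i] Q'[OF i]] by blast
qed

text \<open>
  The summed inequality bounds \<open>2 v \<bullet> R v\<close> from below by a positive form, so \<open>R\<close> is invertible, and
  the congruence \<open>Q i \<mapsto> R\<^sup>-\<^sup>T Q i R\<^sup>-\<^sup>1\<close> is available. The supremum in \<open>fenchel_young\<close> is
  then evaluated at two points. For the sum of the matrices, the point \<open>R v\<close> gives a lower bound
  that suffices. For each single matrix the supremum has to be bounded from above, so the point is
  its maximizer, which invertibility of \<open>R\<close> allows to be written as \<open>R w\<close>.
\<close>

theorem riccati_of_lmi: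
  fixes A S Q :: "'i \<Rightarrow> real^'n^'n" and R :: "real^'n^'n"
  assumes I: "finite I" "I \<noteq> {}"
    and S: "\<And>i. i \<in> I \<Longrightarrow> positive_definite (S i)"
    and Q: "\<And>i. i \<in> I \<Longrightarrow> positive_definite (Q i)"
    and less: "(\<Sum>i\<in>I. Q i) + (\<Sum>i\<in>I. S i) - (transpose R + R) \<prec>\<^sub>L 0"
    and block: "\<And>i. i \<in> I \<Longrightarrow> block_matrix (- S i) (r i *\<^sub>R (transpose (A i) ** R))
                        (r i *\<^sub>R (transpose R ** A i)) (- Q i) \<prec>\<^sub>L 0"
  defines "Q' \<equiv> \<lambda>i. transpose (matrix_inv R) ** Q i ** matrix_inv R"
  shows "\<And>i. i \<in> I \<Longrightarrow> positive_definite (Q' i)"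
    and "\<And>i. i \<in> I \<Longrightarrow>
      (r i)\<^sup>2 *\<^sub>R (transpose (A i) ** matrix_inv (Q' i) ** A i) - S i \<prec>\<^sub>L 0"
    and "(\<Sum>i\<in>I. S i) \<prec>\<^sub>L matrix_inv (\<Sum>i\<in>I. Q' i)"
proof -
  let ?W = "\<Sum>i\<in>I. Q i"
  have W: "positive_definite ?W" and SS: "positive_definite (\<Sum>i\<in>I. S i)"
    using positive_definite_sum I S Q by blast+
  have gap: "v \<bullet> (?W *v v) + v \<bullet> ((\<Sum>i\<in>I. S i) *v v) < 2 * (v \<bullet> (R *v v))" if "v \<noteq> 0" for v
    using less that unfolding symmetrized_sum_less_zero_iff[OF SS W] by blast
  have R_inv: "invertible R"
  proof (rule invertible_if_inner_pos)
    fix v :: "real^'n" assume "v \<noteq> 0"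
    then show "0 < v \<bullet> (R *v v)"
      using gap[of v] positive_definite_nonneg[OF W, of v] positive_definite_nonneg[OF SS, of v]
      by linarith
  qed
  show Q': "positive_definite (Q' i)" if "i \<in> I" for i
    unfolding Q'_def
    by (intro positive_definite_congruence Q that invertible_matrix_inv R_inv)
  have form: "(R *v w) \<bullet> (Q' i *v (R *v w)) = w \<bullet> (Q i *v w)" for i w
    unfolding Q'_def
    by (simp only: matrix_vector_mul_assoc[symmetric] inner_matrix_vector_transpose[of "R *v w"]
        transpose_transpose matrix_inv_cancel[OF R_inv])
  show "(\<Sum>i\<in>I. S i) \<prec>\<^sub>L matrix_inv (\<Sum>i\<in>I. Q' i)"
  proof -
    have W': "positive_definite (\<Sum>i\<in>I. Q' i)"
      using positive_definite_sum I Q' by blast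
    have "v \<bullet> ((\<Sum>i\<in>I. S i) *v v) < v \<bullet> (matrix_inv (\<Sum>i\<in>I. Q' i) *v v)" if "v \<noteq> 0" for v
      using gap[OF that] fenchel_young[OF W', of "R *v v" v]
      by (simp add: inner_sum_matrix form inner_commute)
    then show ?thesis unfolding less_matrix_inv_iff[OF SS W'] by blast
  qed
  fix i assume i: "i \<in> I"
  have "(r i *\<^sub>R (A i *v u)) \<bullet> (matrix_inv (Q' i) *v (r i *\<^sub>R (A i *v u))) < u \<bullet> (S i *v u)"
    if "u \<noteq> 0" for u
  proof -
    define v where "v = r i *\<^sub>R (A i *v u)"
    define w where "w = matrix_inv R *v (matrix_inv (Q' i) *v v)"
    have Rw: "R *v w = matrix_inv (Q' i) *v v"
      by (simp add: w_def matrix_inv_cancel R_inv)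
    have "v \<bullet> (matrix_inv (Q' i) *v v) = 2 * ((R *v w) \<bullet> v) - (R *v w) \<bullet> (Q' i *v (R *v w))"
      unfolding Rw by (rule fenchel_young_attained[OF Q'[OF i], symmetric])
    moreover have "2 * ((R *v w) \<bullet> v) < u \<bullet> (S i *v u) + w \<bullet> (Q i *v w)"
      using block[OF i] that unfolding delay_block_less_zero_iff[OF S[OF i] Q[OF i]] v_def by blast
    ultimately show ?thesis by (simp add: form v_def)
  qed
  then show "(r i)\<^sup>2 *\<^sub>R (transpose (A i) ** matrix_inv (Q' i) ** A i) - S i \<prec>\<^sub>L 0"
    unfolding riccati_less_zero_iff[OF S[OF i] Q'[OF i]] by blast
qed

section \<open>Functions bounded by averages of their past\<close>

lemma integrable_on_window:
  fixes G :: "real \<Rightarrow> 'a::banach"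
  assumes "\<And>T. 0 \<le> T \<Longrightarrow> G integrable_on {-r..T}" "- r \<le> a"
  shows "G integrable_on {a..b}"
proof (rule integrable_subinterval_real)
  show "G integrable_on {-r..max 0 b}" by (rule assms(1)) simp
qed (use assms(2) in auto)

text \<open>
  Each point of \<open>[-r, T]\<close> lies in the windows \<open>[t - \<sigma>, t]\<close> of a set of \<open>t\<close> of length at most \<open>\<sigma>\<close>. The
  proof avoids exchanging two integrals: with the primitive \<open>H\<close> of \<open>G\<close>, the integral over the window
  is \<open>H t - H (t - \<sigma>)\<close>, and integrating this difference telescopes to an integral of \<open>H\<close> over
  \<open>[T - \<sigma>, T]\<close> minus a nonnegative one. Since \<open>H\<close> increases, it is at most \<open>H T\<close> there.
\<close>

lemma integral_window_le:
  fixes G :: "real \<Rightarrow> real"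
  assumes int: "\<And>T. 0 \<le> T \<Longrightarrow> G integrable_on {-r..T}"
    and nonneg: "\<And>s. - r \<le> s \<Longrightarrow> 0 \<le> G s"
    and "0 < \<sigma>" "\<sigma> \<le> r" "0 \<le> T"
  shows "(\<lambda>t. integral {t - \<sigma>..t} G) integrable_on {0..T}"
    and "integral {0..T} (\<lambda>t. integral {t - \<sigma>..t} G) \<le> \<sigma> * integral {-r..T} G"
proof -
  define H where "H t = integral {-r..t} G" for t
  note G_int = integrable_on_window[OF int]
  have "continuous_on {-r..T} H"
    unfolding H_def by (rule indefinite_integral_continuous_1[OF int[OF \<open>0 \<le> T\<close>]])
  then have H_int: "H integrable_on {a..b}" if "- r \<le> a" "b \<le> T" for a b
    by (rule integrable_continuous_real[OF continuous_on_subset]) (use that in auto)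
  have split: "integral {t - \<sigma>..t} G = H t - H (t - \<sigma>)" if "0 \<le> t" for t
    using Henstock_Kurzweil_Integration.integral_combine[of "-r" "t - \<sigma>" t G] G_int[of "-r" t] that assms(3,4)
    by (simp add: H_def)
  have shift: "((\<lambda>t. H (t - \<sigma>)) has_integral integral {-\<sigma>..T - \<sigma>} H) {0..T}"
    using has_integral_shift_real_ivl[of H "integral {-\<sigma>..T - \<sigma>} H" "-\<sigma>" "T - \<sigma>" "-\<sigma>"]
      integrable_integral[OF H_int[of "-\<sigma>" "T - \<sigma>"]] assms(3,4) by simp
  have diff: "((\<lambda>t. integral {t - \<sigma>..t} G) has_integral
      integral {0..T} H - integral {-\<sigma>..T - \<sigma>} H) {0..T}"
    by (rule has_integral_eq[OF _ has_integral_diff[OF integrable_integral[OF H_int[of 0 T]] shift]])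
       (use split assms in auto)
  then show "(\<lambda>t. integral {t - \<sigma>..t} G) integrable_on {0..T}"
    by (rule has_integral_integrable)
  have H_nonneg: "0 \<le> H t" if "- r \<le> t" for t
    unfolding H_def by (rule integral_nonneg[OF G_int]) (use nonneg in auto)
  have H_mono: "H s \<le> H t" if "- r \<le> s" "s \<le> t" for s t
    unfolding H_def by (rule integral_subset_le) (use that nonneg in \<open>auto intro: G_int\<close>)
  have "integral {-\<sigma>..0} H + integral {0..T} H = integral {-\<sigma>..T} H"
    "integral {-\<sigma>..T - \<sigma>} H + integral {T - \<sigma>..T} H = integral {-\<sigma>..T} H"
    using assms by (auto intro!: Henstock_Kurzweil_Integration.integral_combine H_int)
  moreover have "0 \<le> integral {-\<sigma>..0} H"
    using assms by (intro integral_nonneg H_int H_nonneg) auto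
  moreover have "integral {T - \<sigma>..T} H \<le> integral {T - \<sigma>..T} (\<lambda>_. H T)"
    using assms by (intro integral_le H_int H_mono) auto
  ultimately show "integral {0..T} (\<lambda>t. integral {t - \<sigma>..t} G) \<le> \<sigma> * integral {-r..T} G"
    using integral_unique[OF diff] assms(3) by (simp add: H_def)
qed

text \<open>
  A function that is bounded by averages of its past, with a total weight \<open>\<kappa> < 1\<close>, is bounded by its
  initial data. Integrating the hypothesis and applying \<open>integral_window_le\<close> bounds the integral of
  \<open>F\<close> over \<open>[0, t]\<close> by \<open>\<kappa>\<close> times its integral over \<open>[-r, t]\<close>. As \<open>\<kappa> < 1\<close>, the latter integral
  is bounded by a multiple of the one over \<open>[-r, 0]\<close>, uniformly in \<open>t\<close>, and inserting this once more into the
  hypothesis, where only integrals of the \<open>G i\<close> occur, turns it into a pointwise bound.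
\<close>

lemma averaged_inequality_bound:
  fixes F :: "real \<Rightarrow> real" and G :: "'i \<Rightarrow> real \<Rightarrow> real"
  assumes fin: "finite I"
    and \<sigma>: "\<And>i. i \<in> I \<Longrightarrow> m \<le> \<sigma> i \<and> \<sigma> i \<le> r"
    and m: "0 < m"
    and r: "0 \<le> r"
    and F_int: "\<And>T. 0 \<le> T \<Longrightarrow> F integrable_on {-r..T}"
    and G_int: "\<And>i T. i \<in> I \<Longrightarrow> 0 \<le> T \<Longrightarrow> G i integrable_on {-r..T}"
    and G_nonneg: "\<And>i s. i \<in> I \<Longrightarrow> - r \<le> s \<Longrightarrow> 0 \<le> G i s"
    and contr: "\<And>s. - r \<le> s \<Longrightarrow> (\<Sum>i\<in>I. G i s) \<le> \<kappa> * F s"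
    and \<kappa>: "0 \<le> \<kappa>" "\<kappa> < 1"
    and avg: "\<And>t. 0 \<le> t \<Longrightarrow> F t \<le> (\<Sum>i\<in>I. integral {t - \<sigma> i..t} (G i) / \<sigma> i)"
    and t: "0 \<le> t"
  shows "F t \<le> \<kappa> / (m * (1 - \<kappa>)) * integral {-r..0} F"
proof -
  have G_le: "(\<Sum>i\<in>I. integral {-r..t} (G i)) \<le> \<kappa> * integral {-r..t} F"
  proof -
    have "(\<Sum>i\<in>I. integral {-r..t} (G i)) = integral {-r..t} (\<lambda>s. \<Sum>i\<in>I. G i s)"
      using fin G_int t by (subst integral_sum) auto
    also have "\<dots> \<le> integral {-r..t} (\<lambda>s. \<kappa> * F s)"
      using t contr by (intro integral_le integrable_sum fin G_int integrable_on_mult_right F_int) auto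
    finally show ?thesis by simp
  qed
  have win: "(\<lambda>t. integral {t - \<sigma> i..t} (G i) / \<sigma> i) integrable_on {0..t}"
    "integral {0..t} (\<lambda>t. integral {t - \<sigma> i..t} (G i) / \<sigma> i) \<le> integral {-r..t} (G i)"
    if "i \<in> I" for i
  proof -
    have s: "0 < \<sigma> i" "\<sigma> i \<le> r" using \<sigma>[OF that] m by auto
    note w = integral_window_le[OF G_int[OF that] G_nonneg[OF that] s t]
    show "(\<lambda>t. integral {t - \<sigma> i..t} (G i) / \<sigma> i) integrable_on {0..t}"
      using integrable_on_divide[OF w(1)] by simp
    show "integral {0..t} (\<lambda>t. integral {t - \<sigma> i..t} (G i) / \<sigma> i) \<le> integral {-r..t} (G i)"
      using w(2) s by (simp add: divide_le_eq mult.commute)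
  qed
  have "integral {0..t} F \<le> integral {0..t} (\<lambda>t. \<Sum>i\<in>I. integral {t - \<sigma> i..t} (G i) / \<sigma> i)"
    using r by (intro integral_le integrable_on_window[OF F_int] integrable_sum fin win(1) avg) auto
  also have "\<dots> = (\<Sum>i\<in>I. integral {0..t} (\<lambda>t. integral {t - \<sigma> i..t} (G i) / \<sigma> i))"
    by (intro integral_sum fin win(1))
  also have "\<dots> \<le> (\<Sum>i\<in>I. integral {-r..t} (G i))"
    by (intro sum_mono win(2))
  also note G_le
  finally have "integral {0..t} F \<le> \<kappa> * integral {-r..t} F" .
  moreover have "integral {-r..0} F + integral {0..t} F = integral {-r..t} F"
    using r t by (intro Henstock_Kurzweil_Integration.integral_combine F_int) auto
  ultimately have "integral {-r..t} F * (1 - \<kappa>) \<le> integral {-r..0} F"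
    by (simp add: algebra_simps)
  then have F_total: "integral {-r..t} F \<le> integral {-r..0} F / (1 - \<kappa>)"
    using \<kappa>(2) by (simp add: pos_le_divide_eq)
  have "F t \<le> (\<Sum>i\<in>I. integral {t - \<sigma> i..t} (G i) / \<sigma> i)" by (rule avg[OF t])
  also have "\<dots> \<le> (\<Sum>i\<in>I. integral {-r..t} (G i) / m)"
  proof (rule sum_mono)
    fix i assume i: "i \<in> I"
    have "integral {t - \<sigma> i..t} (G i) \<le> integral {-r..t} (G i)"
      using \<sigma>[OF i] m t
      by (intro integral_subset_le integrable_on_window[OF G_int[OF i]])
         (auto intro: G_nonneg[OF i])
    moreover have "0 \<le> integral {-r..t} (G i)"
      by (intro integral_nonneg G_int i t G_nonneg) auto
    ultimately show "integral {t - \<sigma> i..t} (G i) / \<sigma> i \<le> integral {-r..t} (G i) / m"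
      using \<sigma>[OF i] m by (intro frac_le) auto
  qed
  also have "\<dots> \<le> \<kappa> * integral {-r..t} F / m"
    using G_le m by (simp add: sum_divide_distrib[symmetric] divide_right_mono)
  also have "\<dots> \<le> \<kappa> * (integral {-r..0} F / (1 - \<kappa>)) / m"
    using F_total m \<kappa>(1) by (intro divide_right_mono mult_left_mono) auto
  finally show ?thesis by (simp add: mult_ac)
qed

section \<open>Exponential stability\<close>

text \<open>
  With \<open>m\<close> the mean value of \<open>x\<close>, this is nonnegativity of the integral of
  \<open>(x s - m) \<bullet> S (x s - m)\<close>, expanded.
\<close>

lemma jensen_quadratic_form:
  fixes S :: "real^'n^'n" and x :: "real \<Rightarrow> real^'n"
  assumes S: "positive_definite S" and ab: "a < b"
    and x: "x integrable_on {a..b}" and q: "(\<lambda>s. x s \<bullet> (S *v x s)) integrable_on {a..b}"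
  shows "integral {a..b} x \<bullet> (S *v integral {a..b} x) \<le> (b - a) * integral {a..b} (\<lambda>s. x s \<bullet> (S *v x s))"
proof -
  define w where "w = integral {a..b} x"
  define m where "m = (1 / (b - a)) *\<^sub>R w"
  let ?q = "\<lambda>s. x s \<bullet> (S *v x s)"
  have lin: "((\<lambda>s. (S *v m) \<bullet> x s) has_integral (S *v m) \<bullet> w) {a..b}"
    using has_integral_linear[OF integrable_integral[OF x] bounded_linear_inner_right[of "S *v m"]]
    by (simp add: o_def w_def)
  have "((\<lambda>s. m \<bullet> (S *v m)) has_integral (b - a) * (m \<bullet> (S *v m))) {a..b}"
    using has_integral_const_real[of "m \<bullet> (S *v m)" a b] ab by simp
  from has_integral_add[OF has_integral_diff[OF integrable_integral[OF q]
        has_integral_mult_right[OF lin, of 2]] this]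
  have "((\<lambda>s. ?q s - 2 * ((S *v m) \<bullet> x s) + m \<bullet> (S *v m)) has_integral
      integral {a..b} ?q - 2 * ((S *v m) \<bullet> w) + (b - a) * (m \<bullet> (S *v m))) {a..b}" .
  moreover have "?q s - 2 * ((S *v m) \<bullet> x s) + m \<bullet> (S *v m) = (x s - m) \<bullet> (S *v (x s - m))" for s
    using positive_definite_sym[OF S, of m "x s"]
    by (simp add: inner_diff_left inner_diff_right matrix_vector_mult_diff_distrib inner_commute)
  ultimately have "0 \<le> integral {a..b} ?q - 2 * ((S *v m) \<bullet> w) + (b - a) * (m \<bullet> (S *v m))"
    using positive_definite_nonneg[OF S] by (auto intro: has_integral_nonneg)
  also have "\<dots> = integral {a..b} ?q - (w \<bullet> (S *v w)) / (b - a)"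
  proof -
    define l where "l = b - a"
    have "l \<noteq> 0" using ab by (simp add: l_def)
    then show ?thesis
      unfolding m_def l_def[symmetric]
      by (simp add: matrix_vector_mult_scaleR inner_commute field_simps)
  qed
  finally show ?thesis
    using ab by (simp add: w_def[symmetric] pos_divide_le_eq mult.commute)
qed

context
  fixes N :: nat and A :: "nat \<Rightarrow> real^'n^'n" and \<tau> :: "nat \<Rightarrow> real"
  assumes N: "N \<ge> 1" and \<tau>_pos: "\<And>i. i \<in> {1..N} \<Longrightarrow> \<tau> i > 0"
begin

lemma delay_le_max: "i \<in> {1..N} \<Longrightarrow> \<tau> i \<le> max_delay N \<tau>"
  by (simp add: max_delay_def)

lemma max_delay_attained: obtains i where "i \<in> {1..N}" "\<tau> i = max_delay N \<tau>"
proof -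
  have "max_delay N \<tau> \<in> \<tau> ` {1..N}"
    unfolding max_delay_def using N by (intro Max_in) auto
  then show ?thesis using that by auto
qed

lemma max_delay_pos: "max_delay N \<tau> > 0"
  by (metis max_delay_attained \<tau>_pos)

text \<open>
  The longest delay gives integrability over every interval \<open>[t - r, t]\<close> with \<open>t \<ge> 0\<close>, where \<open>r\<close> is
  the maximal delay, and finitely many of these cover a given bounded interval.
\<close>

lemma solution_integrable:
  assumes sol: "ids_solution N A \<tau> \<phi> x"
  shows "x integrable_on {-max_delay N \<tau>..T}"
proof -
  let ?r = "max_delay N \<tau>"
  obtain i where i: "i \<in> {1..N}" "\<tau> i = ?r" by (rule max_delay_attained)
  have step: "x integrable_on {t - ?r..t}" if "0 \<le> t" for t
  proof -
    have "(\<lambda>s. x (s + t)) integrable_on {(t - ?r) - t..t - t}"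
      using sol that i(1) by (simp add: ids_solution_def i(2)[symmetric] add.commute[of _ t])
    then show ?thesis by (simp only: integrable_shift_real_ivl_iff)
  qed
  have all: "x integrable_on {-?r..real k * ?r}" for k :: nat
  proof (induction k)
    case 0
    show ?case using step[of 0] by simp
  next
    case (Suc k)
    have "- ?r \<le> 0" "0 \<le> real k * ?r" using max_delay_pos by simp_all
    then have "- ?r \<le> real k * ?r" by (rule order_trans)
    moreover have "x integrable_on {real k * ?r..real (Suc k) * ?r}"
      using step[of "real (Suc k) * ?r"] max_delay_pos by (simp add: algebra_simps)
    ultimately show ?case
      using Suc max_delay_pos
      by (intro Henstock_Kurzweil_Integration.integrable_combine[OF _ _ Suc]) (auto simp: algebra_simps)
  qed
  obtain k :: nat where "T \<le> real k * ?r"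
    using reals_Archimedean3[OF max_delay_pos] less_imp_le by blast
  then show ?thesis
    by (intro integrable_subinterval_real[OF all[of k]]) auto
qed

lemma solution_eq:
  assumes sol: "ids_solution N A \<tau> \<phi> x" and t: "0 \<le> t"
  shows "x t = (\<Sum>i=1..N. A i *v integral {t - \<tau> i..t} x)"
proof -
  have "integral {-\<tau> i..0} (\<lambda>s. x (t + s)) = integral {t - \<tau> i..t} x" for i
    using integral_shift_real_ivl[of "t - \<tau> i" t t x] by (simp add: add.commute)
  then show ?thesis using sol t by (simp add: ids_solution_def)
qed

text \<open>
  By the equation, \<open>x\<close> is on \<open>[0, \<infinity>)\<close> a linear combination of increments of its own primitive, which
  is continuous.
\<close>

lemma solution_continuous:
  assumes sol: "ids_solution N A \<tau> \<phi> x"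
  shows "continuous_on {0..T} x"
proof -
  let ?r = "max_delay N \<tau>"
  define H where "H t = integral {-?r..t} x" for t
  have H: "continuous_on {-?r..T} H"
    unfolding H_def by (rule indefinite_integral_continuous_1[OF solution_integrable[OF sol]])
  have x_eq: "x t = (\<Sum>i=1..N. A i *v (H t - H (t - \<tau> i)))" if "t \<in> {0..T}" for t
  proof -
    have "integral {t - \<tau> i..t} x = H t - H (t - \<tau> i)" if "i \<in> {1..N}" for i
      using Henstock_Kurzweil_Integration.integral_combine[of "-?r" "t - \<tau> i" t x]
        solution_integrable[OF sol, of t] delay_le_max[OF that] \<tau>_pos[OF that] \<open>t \<in> {0..T}\<close>
      by (simp add: H_def algebra_simps)
    then show ?thesis
      using solution_eq[OF sol, of t] that by (auto intro!: sum.cong)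
  qed
  have "continuous_on {0..T} (\<lambda>t. \<Sum>i=1..N. A i *v (H t - H (t - \<tau> i)))"
  proof (intro continuous_on_sum bounded_linear.continuous_on[OF matrix_vector_mul_bounded_linear]
      continuous_on_diff)
    fix i assume i: "i \<in> {1..N}"
    show "continuous_on {0..T} H"
      by (rule continuous_on_subset[OF H]) (use max_delay_pos in auto)
    show "continuous_on {0..T} (\<lambda>t. H (t - \<tau> i))"
      by (rule continuous_on_compose2[OF H])
         (use delay_le_max[OF i] \<tau>_pos[OF i] in \<open>auto intro!: continuous_intros\<close>)
  qed
  then show ?thesis by (rule continuous_on_eq) (simp only: x_eq)
qed

text \<open>
  The solution may jump at \<open>0\<close>, so the times before and after are treated separately, with \<open>r\<close> the
  maximal delay. On \<open>[0, T]\<close> the integrand is continuous. On \<open>[-r, 0]\<close> the solution differs from the continuous \<open>\<phi>\<close> in at most the point \<open>0\<close>, which an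
  integral does not see.
\<close>

lemma solution_compose_integrable:
  fixes k :: "real \<times> (real^'n) \<Rightarrow> real"
  assumes sol: "ids_solution N A \<tau> \<phi> x" and \<phi>: "continuous_on {-max_delay N \<tau>..0} \<phi>"
    and k: "continuous_on UNIV k" and T: "0 \<le> T"
  shows "(\<lambda>t. k (t, x t)) integrable_on {-max_delay N \<tau>..T}"
proof (rule Henstock_Kurzweil_Integration.integrable_combine[of _ 0])
  have comp: "continuous_on X (\<lambda>t. k (t, y t))" if "continuous_on X y" for X y
    by (rule continuous_on_compose2[OF k]) (use that in \<open>auto intro!: continuous_intros\<close>)
  have "(\<lambda>t. k (t, \<phi> t)) integrable_on {-max_delay N \<tau>..0}"
    by (intro integrable_continuous_real comp \<phi>)
  then show "(\<lambda>t. k (t, x t)) integrable_on {-max_delay N \<tau>..0}"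
    by (rule integrable_spike_finite[of "{0}", rotated 2])
       (use sol in \<open>auto simp: ids_solution_def\<close>)
  show "(\<lambda>t. k (t, x t)) integrable_on {0..T}"
    by (intro integrable_continuous_real comp solution_continuous[OF sol])
qed (use max_delay_pos T in auto)

lemma solution_weighted_form_integrable:
  assumes "ids_solution N A \<tau> \<phi> x" "continuous_on {-max_delay N \<tau>..0} \<phi>" "0 \<le> T"
  shows "(\<lambda>s. exp (b * s) * (x s \<bullet> (B *v x s))) integrable_on {-max_delay N \<tau>..T}"
proof -
  have "continuous_on UNIV (\<lambda>z :: real \<times> (real^'n). exp (b * fst z) * (snd z \<bullet> (B *v snd z)))"
    by (intro continuous_intros continuous_on_inner
        bounded_linear.continuous_on[OF matrix_vector_mul_bounded_linear])
  from solution_compose_integrable[OF assms(1,2) this assms(3)] show ?thesis by simp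
qed

text \<open>
  Write \<open>x t\<close> as the sum of the vectors \<open>A i w i\<close>, where \<open>w i\<close> is the integral of \<open>x\<close> over the
  \<open>i\<close>-th window. Then \<open>inverse_sum_form_le\<close> separates the summands, the matrix inequality replaces
  the form at \<open>A i w i\<close> by that of \<open>S i\<close> at \<open>w i\<close> divided by \<open>\<tau> i\<^sup>2\<close>, and Jensen's inequality
  moves the form inside the integral at the cost of a factor \<open>\<tau> i\<close>.
\<close>

lemma riccati_history_bound:
  fixes S Q :: "nat \<Rightarrow> real^'n^'n"
  assumes SQ: "\<And>i. i \<in> {1..N} \<Longrightarrow> positive_definite (S i) \<and> positive_definite (Q i)"
    and riccati: "\<And>i. i \<in> {1..N} \<Longrightarrow>
      (\<tau> i)\<^sup>2 *\<^sub>R (transpose (A i) ** matrix_inv (Q i) ** A i) - S i \<prec>\<^sub>L 0"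
    and sol: "ids_solution N A \<tau> \<phi> x" and \<phi>: "continuous_on {-max_delay N \<tau>..0} \<phi>"
    and t: "0 \<le> t"
  shows "x t \<bullet> (matrix_inv (\<Sum>i=1..N. Q i) *v x t)
    \<le> (\<Sum>i=1..N. integral {t - \<tau> i..t} (\<lambda>s. x s \<bullet> (S i *v x s)) / \<tau> i)"
proof -
  define w where "w i = integral {t - \<tau> i..t} x" for i
  have "x t \<bullet> (matrix_inv (\<Sum>i=1..N. Q i) *v x t)
      \<le> (\<Sum>i=1..N. (A i *v w i) \<bullet> (matrix_inv (Q i) *v (A i *v w i)))"
    unfolding solution_eq[OF sol t] w_def
    by (rule inverse_sum_form_le) (use N SQ in auto)
  also have "\<dots> \<le> (\<Sum>i=1..N. integral {t - \<tau> i..t} (\<lambda>s. x s \<bullet> (S i *v x s)) / \<tau> i)"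
  proof (rule sum_mono)
    fix i assume i: "i \<in> {1..N}"
    note p = \<tau>_pos[OF i]
    have win: "f integrable_on {t - \<tau> i..t}"
      if "f integrable_on {-max_delay N \<tau>..t}" for f :: "real \<Rightarrow> 'b::banach"
      by (rule integrable_subinterval_real[OF that]) (use delay_le_max[OF i] t in auto)
    have "(\<tau> i *\<^sub>R (A i *v w i)) \<bullet> (matrix_inv (Q i) *v (\<tau> i *\<^sub>R (A i *v w i))) \<le> w i \<bullet> (S i *v w i)"
      using riccati[OF i] SQ[OF i] riccati_less_zero_iff[of "S i" "Q i" "\<tau> i" "A i"]
      by (cases "w i = 0") (auto intro: less_imp_le)
    also have "\<dots> \<le> (t - (t - \<tau> i)) * integral {t - \<tau> i..t} (\<lambda>s. x s \<bullet> (S i *v x s))"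
      unfolding w_def
    proof (rule jensen_quadratic_form)
      show "(\<lambda>s. x s \<bullet> (S i *v x s)) integrable_on {t - \<tau> i..t}"
        using win[OF solution_weighted_form_integrable[OF sol \<phi> t, of 0 "S i"]] by simp
    qed (use SQ[OF i] p in \<open>auto intro: win solution_integrable[OF sol]\<close>)
    finally have "\<tau> i * (\<tau> i * ((A i *v w i) \<bullet> (matrix_inv (Q i) *v (A i *v w i))))
        \<le> \<tau> i * integral {t - \<tau> i..t} (\<lambda>s. x s \<bullet> (S i *v x s))"
      by (simp add: matrix_vector_mult_scaleR)
    then show "(A i *v w i) \<bullet> (matrix_inv (Q i) *v (A i *v w i))
        \<le> integral {t - \<tau> i..t} (\<lambda>s. x s \<bullet> (S i *v x s)) / \<tau> i"
      using p by (simp add: pos_le_divide_eq mult.commute)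
  qed
  finally show ?thesis .
qed

text \<open>
  The weight \<open>exp (2 \<beta> t)\<close> changes by a factor of at most \<open>exp (2 \<beta> r)\<close> within a window. Multiplying
  \<open>riccati_history_bound\<close> by it therefore gives an inequality of the same kind with \<open>\<kappa>\<close> enlarged to
  \<open>\<kappa>'\<close>, to which \<open>averaged_inequality_bound\<close> applies as long as \<open>\<kappa>' < 1\<close>.
\<close>

lemma weighted_solution_bound:
  fixes S Q :: "nat \<Rightarrow> real^'n^'n"
  assumes SQ: "\<And>i. i \<in> {1..N} \<Longrightarrow> positive_definite (S i) \<and> positive_definite (Q i)"
    and riccati: "\<And>i. i \<in> {1..N} \<Longrightarrow>
      (\<tau> i)\<^sup>2 *\<^sub>R (transpose (A i) ** matrix_inv (Q i) ** A i) - S i \<prec>\<^sub>L 0"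
    and contr: "\<And>v. v \<bullet> ((\<Sum>i=1..N. S i) *v v) \<le> \<kappa> * (v \<bullet> (matrix_inv (\<Sum>i=1..N. Q i) *v v))"
    and \<beta>: "0 \<le> \<beta>" and \<kappa>: "0 \<le> \<kappa>" "exp (2 * \<beta> * max_delay N \<tau>) * \<kappa> = \<kappa>'" "\<kappa>' < 1"
    and m: "0 < m" "\<And>i. i \<in> {1..N} \<Longrightarrow> m \<le> \<tau> i"
    and p: "0 \<le> p" "\<And>v. v \<bullet> (matrix_inv (\<Sum>i=1..N. Q i) *v v) \<le> p * (norm v)\<^sup>2"
    and sol: "ids_solution N A \<tau> \<phi> x" and \<phi>: "continuous_on {-max_delay N \<tau>..0} \<phi>"
    and M: "\<And>s. s \<in> {-max_delay N \<tau>..<0} \<Longrightarrow> norm (\<phi> s) \<le> M"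
    and t: "0 \<le> t"
  shows "exp (2 * \<beta> * t) * (x t \<bullet> (matrix_inv (\<Sum>i=1..N. Q i) *v x t))
    \<le> \<kappa>' / (m * (1 - \<kappa>')) * (max_delay N \<tau> * (p * M\<^sup>2))"
proof -
  let ?r = "max_delay N \<tau>" and ?P = "matrix_inv (\<Sum>i=1..N. Q i)"
  have P: "positive_definite ?P"
    by (intro positive_definite_matrix_inv positive_definite_sum) (use N SQ in auto)
  define F where "F t = exp (2 * \<beta> * t) * (x t \<bullet> (?P *v x t))" for t
  define G where "G i s = exp (2 * \<beta> * ?r) * (exp (2 * \<beta> * s) * (x s \<bullet> (S i *v x s)))" for i s
  have weighted_int: "(\<lambda>s. exp (2 * \<beta> * s) * (x s \<bullet> (B *v x s))) integrable_on {-?r..T}"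
    if "0 \<le> T" for B T
    by (rule solution_weighted_form_integrable[OF sol \<phi> that])
  have unweighted_int: "(\<lambda>s. x s \<bullet> (B *v x s)) integrable_on {-?r..T}" if "0 \<le> T" for B T
    using solution_weighted_form_integrable[OF sol \<phi> that, of 0 B] by simp
  have F_int: "F integrable_on {-?r..T}" if "0 \<le> T" for T
    unfolding F_def by (rule weighted_int[OF that])
  have G_int: "G i integrable_on {-?r..T}" if "0 \<le> T" for i T
    unfolding G_def by (intro integrable_on_mult_right weighted_int[OF that])
  have "F t \<le> \<kappa>' / (m * (1 - \<kappa>')) * integral {-?r..0} F"
  proof (rule averaged_inequality_bound[where I = "{1..N}" and G = G and \<sigma> = \<tau>])
    show "0 \<le> \<kappa>'" using \<kappa> by (metis exp_ge_zero mult_nonneg_nonneg)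
    fix s
    have "(\<Sum>i=1..N. G i s) = exp (2 * \<beta> * ?r) * (exp (2 * \<beta> * s) * (x s \<bullet> ((\<Sum>i=1..N. S i) *v x s)))"
      by (simp add: G_def inner_sum_matrix sum_distrib_left)
    also have "\<dots> \<le> exp (2 * \<beta> * ?r) * (exp (2 * \<beta> * s) * (\<kappa> * (x s \<bullet> (?P *v x s))))"
      by (intro mult_left_mono contr) auto
    finally show "(\<Sum>i=1..N. G i s) \<le> \<kappa>' * F s"
      by (simp add: F_def \<kappa>(2)[symmetric] mult_ac)
  next
    fix t :: real assume t: "0 \<le> t"
    have "F t \<le> exp (2 * \<beta> * t) * (\<Sum>i=1..N. integral {t - \<tau> i..t} (\<lambda>s. x s \<bullet> (S i *v x s)) / \<tau> i)"
      unfolding F_def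
      by (intro mult_left_mono riccati_history_bound[OF SQ riccati sol \<phi> t]) auto
    also have "\<dots> = (\<Sum>i=1..N. integral {t - \<tau> i..t} (\<lambda>s. exp (2 * \<beta> * t) * (x s \<bullet> (S i *v x s))) / \<tau> i)"
      by (simp add: sum_distrib_left)
    also have "\<dots> \<le> (\<Sum>i=1..N. integral {t - \<tau> i..t} (G i) / \<tau> i)"
    proof (intro sum_mono divide_right_mono integral_le)
      fix i assume i: "i \<in> {1..N}"
      note b = delay_le_max[OF i] \<tau>_pos[OF i]
      show "(\<lambda>s. exp (2 * \<beta> * t) * (x s \<bullet> (S i *v x s))) integrable_on {t - \<tau> i..t}"
        using b t by (intro integrable_on_mult_right integrable_on_window[OF unweighted_int]) auto
      show "G i integrable_on {t - \<tau> i..t}"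
        using b t by (intro integrable_on_window[OF G_int]) auto
      show "0 \<le> \<tau> i" using b by simp
      fix s assume s: "s \<in> {t - \<tau> i..t}"
      have "2 * \<beta> * t \<le> 2 * \<beta> * (?r + s)"
        using s b \<beta> by (intro mult_left_mono) auto
      then have "exp (2 * \<beta> * t) \<le> exp (2 * \<beta> * ?r) * exp (2 * \<beta> * s)"
        by (simp add: exp_add[symmetric] distrib_left)
      then show "exp (2 * \<beta> * t) * (x s \<bullet> (S i *v x s)) \<le> G i s"
        unfolding G_def mult.assoc[symmetric]
        by (rule mult_right_mono) (use SQ[OF i] positive_definite_nonneg in blast)
    qed
    finally show "F t \<le> (\<Sum>i=1..N. integral {t - \<tau> i..t} (G i) / \<tau> i)" .
  next
    show "0 \<le> G i s" if "i \<in> {1..N}" for i s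
      using SQ[OF that] by (simp add: G_def positive_definite_nonneg)
    show "m \<le> \<tau> i \<and> \<tau> i \<le> ?r" if "i \<in> {1..N}" for i
      using m delay_le_max that by blast
  qed (use \<kappa>(3) m(1) max_delay_pos t in \<open>auto intro: F_int G_int\<close>)
  also have "\<dots> \<le> \<kappa>' / (m * (1 - \<kappa>')) * (?r * (p * M\<^sup>2))"
  proof (rule mult_left_mono)
    \<comment> \<open>The value of \<open>F\<close> at \<open>0\<close> depends on \<open>x 0\<close>, which \<open>M\<close> does not bound.\<close>
    define F0 where "F0 s = (if s = 0 then 0 else F s)" for s
    have "integral {-?r..0} F = integral {-?r..0} F0"
      by (rule integral_spike[of "{0}"]) (auto simp: F0_def)
    also have "\<dots> \<le> integral {-?r..0} (\<lambda>_. p * M\<^sup>2)"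
    proof (rule integral_le)
      show "F0 integrable_on {-?r..0}"
        by (rule integrable_spike_finite[of "{0}", OF _ _ F_int]) (auto simp: F0_def)
      fix s assume s: "s \<in> {-?r..0}"
      show "F0 s \<le> p * M\<^sup>2"
      proof (cases "s = 0")
        case False
        then have s': "s \<in> {-?r..<0}" using s by auto
        then have n: "norm (x s) \<le> M"
          using sol M by (simp add: ids_solution_def)
        have "x s \<bullet> (?P *v x s) \<le> p * M\<^sup>2"
          by (rule order_trans[OF p(2)]) (intro mult_left_mono power_mono n p norm_ge_zero)
        moreover have "exp (2 * \<beta> * s) \<le> 1"
          using \<beta> s' by (simp add: mult_nonneg_nonpos)
        moreover have "0 \<le> x s \<bullet> (?P *v x s)"
          by (rule positive_definite_nonneg[OF P])
        ultimately have "exp (2 * \<beta> * s) * (x s \<bullet> (?P *v x s)) \<le> 1 * (p * M\<^sup>2)"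
          by (intro mult_mono) auto
        then show ?thesis using False by (simp add: F0_def F_def)
      qed (use p in \<open>simp add: F0_def\<close>)
    qed (rule integrable_const_ivl)
    also have "\<dots> = ?r * (p * M\<^sup>2)"
      using max_delay_pos by simp
    finally show "integral {-?r..0} F \<le> ?r * (p * M\<^sup>2)" .
    show "0 \<le> \<kappa>' / (m * (1 - \<kappa>'))"
      using \<kappa> m by (intro divide_nonneg_nonneg) auto
  qed
  finally show ?thesis by (simp add: F_def)
qed

text \<open>
  What remains is to choose the constants independently of the solution. Strictness of the summed
  inequality leaves, by coercivity, a factor \<open>\<kappa> < 1\<close>, and \<open>\<beta>\<close> is taken so small that the weighted
  factor is still below \<open>1\<close>. The square root of the bound on the weighted form is the claimed decay.
\<close>

lemma exponentially_stable_if_riccati: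
  fixes S Q :: "nat \<Rightarrow> real^'n^'n"
  assumes SQ: "\<And>i. i \<in> {1..N} \<Longrightarrow> positive_definite (S i) \<and> positive_definite (Q i)"
    and riccati: "\<And>i. i \<in> {1..N} \<Longrightarrow>
      (\<tau> i)\<^sup>2 *\<^sub>R (transpose (A i) ** matrix_inv (Q i) ** A i) - S i \<prec>\<^sub>L 0"
    and less: "(\<Sum>i=1..N. S i) \<prec>\<^sub>L matrix_inv (\<Sum>i=1..N. Q i)"
  shows "ids_exponentially_stable N A \<tau>"
proof -
  let ?r = "max_delay N \<tau>" and ?P = "matrix_inv (\<Sum>i=1..N. Q i)"
  have "positive_definite (\<Sum>i=1..N. Q i)"
    by (rule positive_definite_sum) (use N SQ in auto)
  then obtain c where c: "c > 0" "\<And>v. c * (norm v)\<^sup>2 \<le> v \<bullet> (?P *v v)"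
    using positive_definite_coercive[OF positive_definite_matrix_inv] by blast
  obtain p where p: "p > 0" "\<And>v. v \<bullet> (?P *v v) \<le> p * (norm v)\<^sup>2"
    using quadratic_form_bounded[of ?P] by blast
  obtain d where d: "d > 0" "\<And>v. d * (norm v)\<^sup>2 \<le> v \<bullet> ((?P - (\<Sum>i=1..N. S i)) *v v)"
    using positive_definite_coercive less unfolding matrix_less_def by blast
  \<comment> \<open>The maximum with \<open>1/2\<close> only keeps \<open>\<kappa>\<close> positive, so that it may be divided by below.\<close>
  define \<kappa> where "\<kappa> = max (1/2) (1 - d / p)"
  have \<kappa>: "1/2 \<le> \<kappa>" "\<kappa> < 1" "1 - d / p \<le> \<kappa>"
    using d(1) p(1) by (auto simp: \<kappa>_def)
  have contr: "v \<bullet> ((\<Sum>i=1..N. S i) *v v) \<le> \<kappa> * (v \<bullet> (?P *v v))" for v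
  proof -
    have "d / p * (v \<bullet> (?P *v v)) \<le> d / p * (p * (norm v)\<^sup>2)"
      using d(1) p by (intro mult_left_mono) auto
    also have "\<dots> \<le> v \<bullet> (?P *v v) - v \<bullet> ((\<Sum>i=1..N. S i) *v v)"
      using d(2)[of v] p(1) by (simp add: matrix_vector_mult_diff_rdistrib inner_diff_right)
    finally have "v \<bullet> ((\<Sum>i=1..N. S i) *v v) \<le> (1 - d / p) * (v \<bullet> (?P *v v))"
      by (simp add: left_diff_distrib)
    also have "\<dots> \<le> \<kappa> * (v \<bullet> (?P *v v))"
      using \<kappa>(3) order_trans[OF _ c(2)[of v]] c(1) by (intro mult_right_mono) auto
    finally show ?thesis .
  qed
  \<comment> \<open>\<open>E\<close> is the midpoint of \<open>1\<close> and \<open>1 / \<kappa>\<close>, so both \<open>1 < E\<close> and \<open>E \<kappa> < 1\<close>.\<close>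
  define E where "E = (1 + 1 / \<kappa>) / 2"
  define \<beta> where "\<beta> = ln E / (2 * ?r)"
  have E: "E > 1" "E * \<kappa> = (\<kappa> + 1) / 2"
    using \<kappa> by (auto simp: E_def field_simps)
  have \<beta>: "\<beta> > 0" "exp (2 * \<beta> * ?r) = E"
    using E(1) max_delay_pos by (auto simp: \<beta>_def)
  define m where "m = Min (\<tau> ` {1..N})"
  have "m \<in> \<tau> ` {1..N}"
    unfolding m_def using N by (intro Min_in) auto
  then have m: "0 < m" "\<And>i. i \<in> {1..N} \<Longrightarrow> m \<le> \<tau> i"
    using \<tau>_pos by (auto simp: m_def)
  let ?\<kappa>' = "(\<kappa> + 1) / 2"
  define D where "D = ?\<kappa>' / (m * (1 - ?\<kappa>')) * (?r * p) / c"
  have D: "D \<ge> 0"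
    unfolding D_def using \<kappa> m(1) max_delay_pos p(1) c(1)
    by (intro divide_nonneg_nonneg mult_nonneg_nonneg) auto
  have "norm (x t) \<le> (sqrt D + 1) * (SUP s\<in>{-?r..<0}. norm (\<phi> s)) * exp (- \<beta> * t)"
    if \<phi>: "continuous_on {-?r..0} \<phi>" and sol: "ids_solution N A \<tau> \<phi> x" and t: "0 \<le> t" for \<phi> x t
  proof -
    define M where "M = (SUP s\<in>{-?r..<0}. norm (\<phi> s))"
    have "bdd_above ((\<lambda>s. norm (\<phi> s)) ` {-?r..0})"
      by (intro bounded_imp_bdd_above compact_imp_bounded compact_continuous_image
          continuous_on_norm \<phi>) auto
    then have "bdd_above ((\<lambda>s. norm (\<phi> s)) ` {-?r..<0})"
      by (rule bdd_above_mono) auto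
    then have M: "norm (\<phi> s) \<le> M" if "s \<in> {-?r..<0}" for s
      unfolding M_def by (rule cSUP_upper[OF that])
    have M0: "M \<ge> 0"
      using order_trans[OF norm_ge_zero M[of "-?r"]] max_delay_pos by simp
    have "c * (exp (\<beta> * t) * norm (x t))\<^sup>2 = exp (2 * \<beta> * t) * (c * (norm (x t))\<^sup>2)"
      by (simp add: power_mult_distrib exp_double[symmetric] mult_ac)
    also have "\<dots> \<le> exp (2 * \<beta> * t) * (x t \<bullet> (?P *v x t))"
      by (intro mult_left_mono c) auto
    also have "\<dots> \<le> ?\<kappa>' / (m * (1 - ?\<kappa>')) * (?r * (p * M\<^sup>2))"
      by (rule weighted_solution_bound[OF SQ riccati contr _ _ _ _ m _ p(2) sol \<phi> M t])
         (use \<beta> E \<kappa> p(1) in auto)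
    also have "\<dots> = c * (D * M\<^sup>2)"
      using c(1) by (simp add: D_def)
    finally have "(exp (\<beta> * t) * norm (x t))\<^sup>2 \<le> (sqrt D * M)\<^sup>2"
      using c(1) D by (simp add: power_mult_distrib)
    then have "exp (\<beta> * t) * norm (x t) \<le> sqrt D * M"
      by (rule power2_le_imp_le) (use D M0 in auto)
    also have "\<dots> \<le> (sqrt D + 1) * M"
      using M0 by (intro mult_right_mono) auto
    finally have "exp (\<beta> * t) * norm (x t) \<le> (sqrt D + 1) * M" .
    then show ?thesis
      unfolding M_def[symmetric] by (simp add: exp_minus inverse_eq_divide pos_le_divide_eq mult.commute)
  qed
  moreover have "sqrt D + 1 > 0" using D by (simp add: add_nonneg_pos)
  ultimately show ?thesis
    unfolding ids_exponentially_stable_def using \<beta>(1) by blast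
qed

end

section \<open>The stability criterion and its linear form\<close>

theorem theorem1:
  fixes N :: nat and A :: "nat \<Rightarrow> real^'n^'n" and \<tau> :: "nat \<Rightarrow> real"
  assumes "N \<ge> 1" and "\<And>i. i \<in> {1..N} \<Longrightarrow> \<tau> i > 0"
  shows
    "((\<exists>S Q :: nat \<Rightarrow> real^'n^'n.
        (\<forall>i\<in>{1..N}. positive_definite (S i) \<and> positive_definite (Q i)) \<and>
        (\<forall>i\<in>{1..N}.
           (\<tau> i)\<^sup>2 *\<^sub>R (transpose (A i) ** matrix_inv (Q i) ** A i) - S i \<prec>\<^sub>L 0) \<and>
        (\<Sum>i=1..N. S i) \<prec>\<^sub>L matrix_inv (\<Sum>i=1..N. Q i))
      \<longrightarrow> ids_exponentially_stable N A \<tau>)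
     \<and>
     ((\<exists>S Q :: nat \<Rightarrow> real^'n^'n.
        (\<forall>i\<in>{1..N}. positive_definite (S i) \<and> positive_definite (Q i)) \<and>
        (\<forall>i\<in>{1..N}.
           (\<tau> i)\<^sup>2 *\<^sub>R (transpose (A i) ** matrix_inv (Q i) ** A i) - S i \<prec>\<^sub>L 0) \<and>
        (\<Sum>i=1..N. S i) \<prec>\<^sub>L matrix_inv (\<Sum>i=1..N. Q i))
      \<longleftrightarrow>
      (\<exists>(S :: nat \<Rightarrow> real^'n^'n) (Q :: nat \<Rightarrow> real^'n^'n) (R :: real^'n^'n).
        (\<forall>i\<in>{1..N}. positive_definite (S i) \<and> positive_definite (Q i)) \<and>
        (\<Sum>i=1..N. Q i) + (\<Sum>i=1..N. S i) - (transpose R + R) \<prec>\<^sub>L 0 \<and>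
        (\<forall>i\<in>{1..N}.
           block_matrix (- S i) (\<tau> i *\<^sub>R (transpose (A i) ** R))
                        (\<tau> i *\<^sub>R (transpose R ** A i)) (- Q i) \<prec>\<^sub>L 0)))"
    (is "(?riccati \<longrightarrow> ?stable) \<and> (?riccati \<longleftrightarrow> ?lmi)")
proof (intro conjI impI iffI)
  have I: "finite {1..N}" "{1..N} \<noteq> {}" using assms(1) by auto
  {
    assume ?riccati
    then obtain S Q :: "nat \<Rightarrow> real^'n^'n" where
      SQ: "\<forall>i\<in>{1..N}. positive_definite (S i) \<and> positive_definite (Q i)" and
      riccati: "\<forall>i\<in>{1..N}.
        (\<tau> i)\<^sup>2 *\<^sub>R (transpose (A i) ** matrix_inv (Q i) ** A i) - S i \<prec>\<^sub>L 0" and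
      less: "(\<Sum>i=1..N. S i) \<prec>\<^sub>L matrix_inv (\<Sum>i=1..N. Q i)"
      by (elim exE conjE)
    note S = conjunct1[OF bspec[OF SQ]] and Q = conjunct2[OF bspec[OF SQ]]
    show ?stable
      by (rule exponentially_stable_if_riccati[OF assms bspec[OF SQ] bspec[OF riccati] less])
    let ?R = "matrix_inv (\<Sum>i=1..N. Q i)"
    note lmi = lmi_of_riccati[where A = A and r = \<tau>, OF I S Q bspec[OF riccati] less]
    show ?lmi
      by (rule exI[of _ S], rule exI[of _ "\<lambda>i. transpose ?R ** Q i ** ?R"], rule exI[of _ ?R])
         (intro conjI ballI S lmi)
  next
    assume ?lmi
    then obtain S Q :: "nat \<Rightarrow> real^'n^'n" and R :: "real^'n^'n" where
      SQ: "\<forall>i\<in>{1..N}. positive_definite (S i) \<and> positive_definite (Q i)" and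
      less: "(\<Sum>i=1..N. Q i) + (\<Sum>i=1..N. S i) - (transpose R + R) \<prec>\<^sub>L 0" and
      block: "\<forall>i\<in>{1..N}.
        block_matrix (- S i) (\<tau> i *\<^sub>R (transpose (A i) ** R))
                        (\<tau> i *\<^sub>R (transpose R ** A i)) (- Q i) \<prec>\<^sub>L 0"
      by (elim exE conjE)
    note S = conjunct1[OF bspec[OF SQ]] and Q = conjunct2[OF bspec[OF SQ]]
    note riccati = riccati_of_lmi[where A = A and r = \<tau>, OF I S Q less bspec[OF block]]
    show ?riccati
      by (rule exI[of _ S],
          rule exI[of _ "\<lambda>i. transpose (matrix_inv R) ** Q i ** matrix_inv R"])
         (intro conjI ballI S riccati)
  }
qed

end
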